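(* Let $m\in\mathbb{N}$ and nonnegative integers $p_1,\ldots,p_{m+1}$ be fixed constants (independent of $d$ and $n$). Let $x^{(1)},\ldots,x^{(n)}$ be sampled independently and uniformly from the hypercube $\{-1,1\}^d$. Fix collections of sets $\mathcal{S}_1,\ldots,\mathcal{S}_{m+1}\subseteq 2^{[d]}$ and weight vectors $w^{(i)}\in\mathbb{R}^{\mathcal{S}_i}_{+}$, $i\in[m+1]$. Define the matrix product $$M=A_1^\top\bigl(A_2A_2^\top\bigr)\cdots\bigl(A_mA_m^\top\bigr)A_{m+1},\qquad A_i=X_{\mathcal{S}_i}\,\mathrm{Diag}(w^{(i)}),$$ where $X_{\mathcal{S}_i}\in\mathbb{R}^{n\times|\mathcal{S}_i|}$ is the Fourier-Walsh matrix of $\mathcal{S}_i$ built from $x^{(1)},\ldots,x^{(n)}$ (the same samples for all $i$). Assume that for all $i,j\in[m+1]$: 1. (degree bound) $|S|\le p_i$ for all $S\in\mathcal{S}_i$; 2. (trivial intersection) whenever $\mathcal{S}_i\cap\mathcal{S}_j\neq\emptyset$, the equality $\mathcal{S}_i=\mathcal{S}_j$ holds; 3. (small weights) $w^{(i)}=O_d\bigl(n^{-1/2}\wedge d^{-p_i/2}\bigr)$ (entrywise). Then the estimate $$\bigl\|\mathbb{E}M\bigr\|_{\mathrm{op}}=O_d\bigl(d^{p_j}\bigr)\,\|w^{(1)}\|_\infty\,\|w^{(m+1)}\|_\infty$$ holds for every index $j\in[m+1]$ such that $\mathcal{S}_j$ is distinct from both $\mathcal{S}_1$ and $\mathcal{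S}_{m+1}$.
   Context: $[d]=\{1,\ldots,d\}$, and $2^{[d]}$ is the family of all subsets of $[d]$. For a family $\mathcal{S}\subseteq 2^{[d]}$ and data points $x^{(1)},\ldots,x^{(n)}\in\{-1,1\}^d$, the Fourier-Walsh matrix $X_{\mathcal{S}}\in\mathbb{R}^{n\times|\mathcal{S}|}$ has rows indexed by $i\in[n]$, columns indexed by $S\in\mathcal{S}$, and $(i,S)$ entry $\prod_{s\in S}x^{(i)}_s$ (equal to $1$ if $S=\emptyset$). $\mathrm{Diag}(w)$ is the diagonal matrix with diagonal $w$; $\mathbb{R}_+$ is the set of nonnegative reals; $a\wedge b=\min\{a,b\}$; $\|\cdot\|_{\mathrm{op}}$ is the spectral (operator) norm; $\|\cdot\|_\infty$ is the maximum absolute entry. The expectation is over the random samples. Asymptotic notation $O_d$ is as $d\to\infty$: $f=O_d(g)$ means $|f|\le Cg$ for all sufficiently large $d$, with a constant $C$ independent of $d$ and $n$ (where $n$ may vary with $d$); in the conclusion the constant depends only on $m$, $p_1,\ldots,p_{m+1}$ and the constants implied in hypothesis 3. *)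

theory Defs
  imports "HOL-Probability.Probability"
begin

text \<open>
  All row and column index sets vary with the dimension and the sample size, so a matrix is a
  function of its two indices, and every operation that sums over an index takes the index set
  as an explicit argument. Only finite index sets are used.
\<close>

type_synonym ('r, 'c) fmat = "'r \<Rightarrow> 'c \<Rightarrow> real"

definition fmat_mult :: "'k set \<Rightarrow> ('r, 'k) fmat \<Rightarrow> ('k, 'c) fmat \<Rightarrow> ('r, 'c) fmat" where
  "fmat_mult I A B = (\<lambda>r c. \<Sum>k\<in>I. A r k * B k c)"

definition fmat_transpose :: "('r, 'c) fmat \<Rightarrow> ('c, 'r) fmat" where
  "fmat_transpose A = (\<lambda>c r. A r c)"

definition fmat_diag :: "('k \<Rightarrow> real) \<Rightarrow> ('k, 'k) fmat" where
  "fmat_diag w = (\<lambda>k l. if k = l then w k else 0)"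

definition op_norm :: "'r set \<Rightarrow> 'c set \<Rightarrow> ('r, 'c) fmat \<Rightarrow> real" where
  "op_norm R C A = (SUP v\<in>{v. L2_set v C \<le> 1}. L2_set (\<lambda>r. \<Sum>c\<in>C. A r c * v c) R)"

text \<open>The inserted \<open>0\<close> only matters for the vector without entries.\<close>

definition max_norm :: "'k set \<Rightarrow> ('k \<Rightarrow> real) \<Rightarrow> real" where
  "max_norm I w = Max (insert 0 ((\<lambda>k. \<bar>w k\<bar>) ` I))"

definition hypercube :: "nat \<Rightarrow> (nat \<Rightarrow> real) set" where
  "hypercube d = {1..d} \<rightarrow>\<^sub>E {-1, 1}"

text \<open>The joint law of \<open>n\<close> independent uniform points; the value \<open>undefined\<close> is
  taken only at indices outside \<open>{1..n}\<close>.\<close>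

definition samples :: "nat \<Rightarrow> nat \<Rightarrow> (nat \<Rightarrow> nat \<Rightarrow> real) pmf" where
  "samples n d = Pi_pmf {1..n} undefined (\<lambda>_. pmf_of_set (hypercube d))"

definition fourier_walsh :: "(nat \<Rightarrow> nat \<Rightarrow> real) \<Rightarrow> (nat, nat set) fmat" where
  "fourier_walsh x = (\<lambda>i S. \<Prod>s\<in>S. x i s)"

definition weighted_fw ::
  "nat set set \<Rightarrow> (nat set \<Rightarrow> real) \<Rightarrow> (nat \<Rightarrow> nat \<Rightarrow> real) \<Rightarrow> (nat, nat set) fmat" where
  "weighted_fw \<S> w x = fmat_mult \<S> (fourier_walsh x) (fmat_diag w)"

text \<open>For \<open>m = 1\<close> the list of middle factors is empty and the product is
  \<open>A\<^sub>1\<^sup>T A\<^sub>2\<close>.\<close>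

definition gram_product ::
  "nat \<Rightarrow> nat \<Rightarrow> (nat \<Rightarrow> nat set set) \<Rightarrow> (nat \<Rightarrow> nat set \<Rightarrow> real) \<Rightarrow> (nat \<Rightarrow> nat \<Rightarrow> real)
    \<Rightarrow> (nat set, nat set) fmat" where
  "gram_product m n \<S> w x =
    (let A = (\<lambda>i. weighted_fw (\<S> i) (w i) x);
         G = (\<lambda>i. fmat_mult (\<S> i) (A i) (fmat_transpose (A i)))
     in fmat_mult {1..n}
          (foldl (fmat_mult {1..n}) (fmat_transpose (A 1)) (map G [2..<m + 1]))
          (A (m + 1)))"

definition expected_fmat :: "'a pmf \<Rightarrow> ('a \<Rightarrow> ('r, 'c) fmat) \<Rightarrow> ('r, 'c) fmat" where
  "expected_fmat P A = (\<lambda>r c. measure_pmf.expectation P (\<lambda>x. A x r c))"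

end

theory Submission
  imports Defs
begin

text \<open>
  Expanding the product, the entry at \<open>S\<close>, \<open>T\<close> is a sum over sample indices \<open>i 1, \<dots>, i m\<close> and sets
  \<open>\<sigma> 1 = S, \<sigma> 2, \<dots>, \<sigma> m, \<sigma> (m + 1) = T\<close>. Read \<open>i\<close> as a walk whose edge from \<open>i (k - 1)\<close> to \<open>i k\<close> is
  labelled \<open>\<sigma> k\<close>. Flipping one coordinate of one sample shows that the expectation of a term vanishes
  unless at every vertex each element \<open>s\<close> lies in an even number of the incident labels. Summing
  these parities gives \<open>S = T\<close>, so the expected matrix is diagonal and the walk closes up.

  Fix \<open>i\<close>. If \<open>{i 1, \<dots>, i (j - 1)}\<close> and \<open>{i j, \<dots>, i m}\<close> were disjoint, the parities would give
  \<open>\<sigma> j = S\<close>, which trivial intersection forbids. Hence the walk remains connected without the edges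
  \<open>1\<close> and \<open>j\<close>, and some spanning tree avoids both. The labels on its edges are determined by the
  others. Bounding the squared weights by \<open>1/n\<close> on the tree and on \<open>j\<close>, and by \<open>d^(-p k)\<close> elsewhere, the
  count of free labels leaves \<open>d^(p j) n^(-r)\<close>, where \<open>r\<close> is the number of vertices of the walk. The
  sum of \<open>n^(-r)\<close> over all \<open>i\<close> is bounded.
\<close>

definition balanced :: "nat \<Rightarrow> (nat \<Rightarrow> 'v) \<Rightarrow> (nat \<Rightarrow> 'a set) \<Rightarrow> bool" where
  "balanced m i \<sigma> \<longleftrightarrow> (\<forall>v s.
     even (\<Sum>k | k \<in> {1..m} \<and> i k = v. of_bool (s \<in> \<sigma> k) + of_bool (s \<in> \<sigma> (Suc k)) :: nat))"

lemma even_telescope: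
  assumes "a \<le> b"
  shows "even (\<Sum>k\<in>{a..<b}. of_bool (P k) + of_bool (P (Suc k)) :: nat) \<longleftrightarrow> P a = P b"
  using assms by (induction b rule: dec_induct) auto

lemma balanced_saturated:
  fixes i :: "nat \<Rightarrow> 'v" and \<sigma> :: "nat \<Rightarrow> 'a set"
  assumes bal: "balanced m i \<sigma>" and B: "B \<subseteq> {1..m}"
    and sat: "\<And>k l. k \<in> B \<Longrightarrow> l \<in> {1..m} \<Longrightarrow> i l = i k \<Longrightarrow> l \<in> B"
  shows "even (\<Sum>k\<in>B. of_bool (s \<in> \<sigma> k) + of_bool (s \<in> \<sigma> (Suc k)) :: nat)"
proof -
  let ?f = "\<lambda>k. of_bool (s \<in> \<sigma> k) + of_bool (s \<in> \<sigma> (Suc k)) :: nat"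
  have fin: "finite B" using B finite_subset by blast
  have "sum ?f B = (\<Sum>v\<in>i ` B. sum ?f {k. k \<in> B \<and> i k = v})"
    using fin by (rule sum.image_gen)
  also have "\<dots> = (\<Sum>v\<in>i ` B. sum ?f {k. k \<in> {1..m} \<and> i k = v})"
    using B sat by (intro sum.cong refl arg_cong[where f = "sum ?f"]) auto
  also have "even \<dots>"
    using bal unfolding balanced_def by (rule_tac dvd_sum) blast
  finally show ?thesis .
qed

lemma balanced_prefix:
  assumes "balanced m i \<sigma>" "1 \<le> q" "q \<le> Suc m"
    and "i ` {1..<q} \<inter> i ` {q..m} = {}"
  shows "\<sigma> 1 = \<sigma> q"
proof (rule set_eqI)
  fix s
  have "even (\<Sum>k\<in>{1..<q}. of_bool (s \<in> \<sigma> k) + of_bool (s \<in> \<sigma> (Suc k)) :: nat)"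
  proof (rule balanced_saturated[OF assms(1)])
    fix k l assume "k \<in> {1..<q}" "l \<in> {1..m}" "i l = i k"
    with assms(4) show "l \<in> {1..<q}"
      by (metis atLeastAtMost_iff atLeastLessThan_iff disjoint_iff imageI not_less)
  qed (use assms(3) in auto)
  then show "s \<in> \<sigma> 1 \<longleftrightarrow> s \<in> \<sigma> q"
    using even_telescope[of 1 q "\<lambda>k. s \<in> \<sigma> k"] assms(2) by simp
qed

text \<open>The trace of the walk stays connected without the edges \<open>1\<close> and \<open>j\<close>.\<close>

lemma crossing_edge:
  fixes i :: "nat \<Rightarrow> 'v"
  assumes ab: "a \<in> {1..<j}" "b \<in> {j..m}" "i a = i b"
    and U: "U \<noteq> {}" "U \<subseteq> i ` {1..m}" "U \<noteq> i ` {1..m}"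
  obtains e where "e \<in> {2..m} - {j}" "(i (e - 1) \<in> U) \<noteq> (i e \<in> U)"
proof (rule ccontr)
  assume "\<not> thesis"
  with that have eq: "(i (e - 1) \<in> U) = (i e \<in> U)" if "e \<in> {2..m}" "e \<noteq> j" for e
    using that by blast
  have lo: "(i k \<in> U) = (i 1 \<in> U)" if "1 \<le> k" "k < j" for k
    using that
  proof (induction k rule: dec_induct)
    case (step k)
    then show ?case using eq[of "Suc k"] ab by auto
  qed simp
  have hi: "(i k \<in> U) = (i j \<in> U)" if "j \<le> k" "k \<le> m" for k
    using that
  proof (induction k rule: dec_induct)
    case (step k)
    then show ?case using eq[of "Suc k"] ab by auto
  qed simp
  have "(i k \<in> U) = (i a \<in> U)" if "k \<in> {1..m}" for k
    using that lo[of k] lo[of a] hi[of k] hi[of b] ab by (cases "k < j") auto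
  then show False using U by blast
qed

text \<open>Leaf elimination in a spanning tree \<open>T\<close> of the trace: the constraint at a vertex added last
  involves only one edge of \<open>T\<close>.\<close>

lemma spanning_tree_determines:
  fixes i :: "nat \<Rightarrow> 'v"
  assumes ab: "a \<in> {1..<j}" "b \<in> {j..m}" "i a = i b"
  obtains T where "T \<subseteq> {2..m} - {j}" "Suc (card T) = card (i ` {1..m})"
    "\<And>(\<sigma> :: nat \<Rightarrow> 'a set) \<sigma>'. balanced m i \<sigma> \<Longrightarrow> balanced m i \<sigma>' \<Longrightarrow>
       (\<And>k. k \<in> {1..Suc m} - T \<Longrightarrow> \<sigma> k = \<sigma>' k) \<Longrightarrow> (\<And>k. k \<in> T \<Longrightarrow> \<sigma> k = \<sigma>' k)"
proof -
  define good where "good U T \<longleftrightarrow> T \<subseteq> {2..m} - {j} \<and> Suc (card T) = card U \<and>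
    (\<forall>k\<in>T. i (k - 1) \<in> U \<and> i k \<in> U) \<and>
    (\<forall>(\<sigma> :: nat \<Rightarrow> 'a set) \<sigma>'. balanced m i \<sigma> \<longrightarrow> balanced m i \<sigma>' \<longrightarrow>
       (\<forall>k \<in> {1..Suc m} - T. \<sigma> k = \<sigma>' k) \<longrightarrow> (\<forall>k \<in> T. \<sigma> k = \<sigma>' k))" for U T
  have "\<exists>U T. U \<subseteq> i ` {1..m} \<and> card U = Suc r \<and> good U T" if "Suc r \<le> card (i ` {1..m})" for r
    using that
  proof (induction r)
    case 0
    have "i 1 \<in> i ` {1..m}" using ab by auto
    then show ?case
      by (intro exI[of _ "{i 1}"] exI[of _ "{}"]) (auto simp: good_def)
  next
    case (Suc r)
    then obtain U T where U: "U \<subseteq> i ` {1..m}" "card U = Suc r" and g: "good U T" by auto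
    have finU: "finite U" using U(1) finite_subset by blast
    have ne: "U \<noteq> {}" "U \<noteq> i ` {1..m}" using U Suc.prems by auto
    obtain e where e: "e \<in> {2..m} - {j}" "(i (e - 1) \<in> U) \<noteq> (i e \<in> U)"
      using crossing_edge[OF ab ne(1) U(1) ne(2)] by blast
    define v where "v = (if i e \<in> U then i (e - 1) else i e)"
    define q where "q = (if i e \<in> U then e - 1 else e)"
    have v: "v \<notin> U" "v \<in> i ` {1..m}" "i (e - 1) \<in> insert v U" "i e \<in> insert v U"
      using e by (auto simp: v_def intro!: imageI)
    have T: "T \<subseteq> {2..m} - {j}" "finite T" "Suc (card T) = card U"
      "\<And>k. k \<in> T \<Longrightarrow> i (k - 1) \<in> U \<and> i k \<in> U"
      using g finite_subset[of T "{2..m}"] unfolding good_def by blast+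
    have det: "\<sigma> k = \<sigma>' k" if "balanced m i \<sigma>" "balanced m i \<sigma>'"
      "\<forall>k \<in> {1..Suc m} - T. \<sigma> k = \<sigma>' k" "k \<in> T" for \<sigma> \<sigma>' :: "nat \<Rightarrow> 'a set" and k
      using g that unfolding good_def by blast
    have eT: "e \<notin> T" using T(4)[of e] e(2) by auto
    have det': "\<sigma> k = \<sigma>' k" if bal: "balanced m i \<sigma>" "balanced m i \<sigma>'"
      and agree: "\<forall>k \<in> {1..Suc m} - insert e T. \<sigma> k = \<sigma>' k" and k: "k \<in> insert e T"
      for \<sigma> \<sigma>' :: "nat \<Rightarrow> 'a set" and k
    proof -
      have "\<sigma> e = \<sigma>' e"
      proof (rule set_eqI)
        fix s :: 'a
        let ?f = "\<lambda>\<sigma> k. of_bool (s \<in> \<sigma> k) + of_bool (s \<in> \<sigma> (Suc k)) :: nat"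
        let ?B = "{k. k \<in> {1..m} \<and> i k = v}"
        have q: "q \<in> ?B" using e by (auto simp: q_def v_def)
        have notT: "k \<notin> insert e T \<and> Suc k \<notin> insert e T" if "k \<in> ?B" "k \<noteq> q" for k
        proof -
          have "i k \<notin> U" "k \<noteq> e" "Suc k \<noteq> e"
            using that v(1) e by (auto simp: q_def v_def split: if_splits)
          then show ?thesis using T(4)[of k] T(4)[of "Suc k"] by auto
        qed
        have split: "sum (?f \<tau>) ?B = ?f \<tau> q + sum (?f \<tau>) (?B - {q})" for \<tau> :: "nat \<Rightarrow> 'a set"
          using q by (intro sum.remove) auto
        have rest: "sum (?f \<sigma>) (?B - {q}) = sum (?f \<sigma>') (?B - {q})"
        proof (intro sum.cong refl)
          fix k assume k: "k \<in> ?B - {q}"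
          then have "\<sigma> k = \<sigma>' k" "\<sigma> (Suc k) = \<sigma>' (Suc k)"
            using notT[of k] agree by auto
          then show "?f \<sigma> k = ?f \<sigma>' k" by simp
        qed
        have par: "even (?f \<sigma> q) = even (?f \<sigma>' q)"
          using bal split[of \<sigma>] split[of \<sigma>'] rest unfolding balanced_def
          by (metis (mono_tags, lifting) even_add)
        show "s \<in> \<sigma> e \<longleftrightarrow> s \<in> \<sigma>' e"
        proof (cases "i e \<in> U")
          case True
          then have qe: "q = e - 1" "Suc q = e" "i q = v" using e by (auto simp: q_def v_def)
          have "q \<notin> insert e T" using T(4)[of q] v(1) qe by auto
          then have "\<sigma> q = \<sigma>' q" using q agree by auto
          then show ?thesis using par qe by (auto split: if_splits)
        next
          case False
          then have qe: "q = e" "i q = v" using e by (auto simp: q_def v_def)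
          have "Suc q \<notin> insert e T" using T(4)[of "Suc q"] v(1) qe by auto
          then have "\<sigma> (Suc q) = \<sigma>' (Suc q)" using q agree by auto
          then show ?thesis using par qe by (auto split: if_splits)
        qed
      qed
      then have "\<forall>l\<in>{1..Suc m} - T. \<sigma> l = \<sigma>' l" using agree by blast
      with \<open>\<sigma> e = \<sigma>' e\<close> show ?thesis using det[OF bal] k by blast
    qed
    have ins: "insert e T \<subseteq> {2..m} - {j}" "Suc (card (insert e T)) = card (insert v U)"
      using T(1-3) e(1) eT v(1) finU by (simp_all add: card_insert_disjoint)
    have ends: "i (k - 1) \<in> insert v U \<and> i k \<in> insert v U" if "k \<in> insert e T" for k
      using that T(4) v by blast
    have "good (insert v U) (insert e T)"
      unfolding good_def
    proof (intro conjI allI impI ballI)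
      fix \<sigma> \<sigma>' :: "nat \<Rightarrow> 'a set" and k
      assume "balanced m i \<sigma>" "balanced m i \<sigma>'" "\<forall>k \<in> {1..Suc m} - insert e T. \<sigma> k = \<sigma>' k"
        "k \<in> insert e T"
      then show "\<sigma> k = \<sigma>' k" by (rule det')
    qed (use ins ends in blast)+
    moreover have "insert v U \<subseteq> i ` {1..m}" "card (insert v U) = Suc (Suc r)"
      using U v finU by auto
    ultimately show ?case by blast
  qed
  moreover have "card (i ` {1..m}) > 0" using ab by (auto simp: card_gt_0_iff)
  ultimately obtain U T where U: "U \<subseteq> i ` {1..m}" "card U = card (i ` {1..m})" "good U T"
    by (metis Suc_pred order_refl) (*LAST*)
  then have "good (i ` {1..m}) T" by (metis card_subset_eq finite_atLeastAtMost finite_imageI)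
  then have T: "T \<subseteq> {2..m} - {j}" "Suc (card T) = card (i ` {1..m})"
    and det: "\<forall>(\<sigma> :: nat \<Rightarrow> 'a set) \<sigma>'. balanced m i \<sigma> \<longrightarrow> balanced m i \<sigma>' \<longrightarrow>
      (\<forall>k \<in> {1..Suc m} - T. \<sigma> k = \<sigma>' k) \<longrightarrow> (\<forall>k \<in> T. \<sigma> k = \<sigma>' k)"
    unfolding good_def by simp_all
  show thesis
  proof (rule that[OF T])
    fix \<sigma> \<sigma>' :: "nat \<Rightarrow> 'a set" and k
    assume "balanced m i \<sigma>" "balanced m i \<sigma>'" "\<And>k. k \<in> {1..Suc m} - T \<Longrightarrow> \<sigma> k = \<sigma>' k" "k \<in> T"
    then show "\<sigma> k = \<sigma>' k" using det by simp
  qed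
qed

lemma sum_PiE_insert:
  assumes "x \<notin> S"
  shows "(\<Sum>f\<in>Pi\<^sub>E (insert x S) T. g f) = (\<Sum>f\<in>Pi\<^sub>E S T. \<Sum>y\<in>T x. g (f(x := y)))"
proof -
  have "(\<Sum>f\<in>Pi\<^sub>E (insert x S) T. g f) = (\<Sum>(y, f)\<in>T x \<times> Pi\<^sub>E S T. g (f(x := y)))"
    unfolding PiE_insert_eq sum.reindex[OF inj_combinator[OF assms]]
    by (intro sum.cong) auto
  also have "\<dots> = (\<Sum>f\<in>Pi\<^sub>E S T. \<Sum>y\<in>T x. g (f(x := y)))"
    by (subst sum.swap) (simp add: sum.cartesian_product)
  finally show ?thesis .
qed

text \<open>The functions with \<open>r\<close> values number at most \<open>n^r\<close> times a constant, so each kernel partition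
  of \<open>A\<close> contributes at most \<open>1\<close>.\<close>

lemma sum_power_card_image_le:
  fixes B :: "'b set"
  assumes "finite A" "finite B" "B \<noteq> {}"
  shows "(\<Sum>i\<in>A \<rightarrow>\<^sub>E B. (1 / real (card B)) ^ card (i ` A)) \<le> fact (card A)"
  using assms(1)
proof (induction A rule: finite_induct)
  case (insert x A)
  let ?c = "1 / real (card B)"
  have n: "real (card B) > 0" using assms by (simp add: card_gt_0_iff)
  have step: "(\<Sum>y\<in>B. ?c ^ card ((f(x := y)) ` insert x A)) \<le> (1 + card A) * ?c ^ card (f ` A)"
    if f: "f \<in> A \<rightarrow>\<^sub>E B" for f
  proof -
    have sub: "f ` A \<subseteq> B" and fin: "finite (f ` A)" using f insert.hyps by auto
    have "(f(x := y)) ` insert x A = insert y (f ` A)" for y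
      using insert.hyps by auto
    then have "(\<Sum>y\<in>B. ?c ^ card ((f(x := y)) ` insert x A)) = (\<Sum>y\<in>B. ?c ^ card (insert y (f ` A)))"
      by simp
    also have "\<dots> = (\<Sum>y\<in>B - f ` A. ?c ^ card (insert y (f ` A))) + (\<Sum>y\<in>f ` A. ?c ^ card (insert y (f ` A)))"
      using sub assms by (intro sum.subset_diff) auto
    also have "(\<Sum>y\<in>B - f ` A. ?c ^ card (insert y (f ` A))) = card (B - f ` A) * ?c * ?c ^ card (f ` A)"
      using fin by simp
    also have "(\<Sum>y\<in>f ` A. ?c ^ card (insert y (f ` A))) = card (f ` A) * ?c ^ card (f ` A)"
      by (simp add: insert_absorb)
    also have "card (B - f ` A) * ?c * ?c ^ card (f ` A) \<le> 1 * ?c ^ card (f ` A)"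
    proof (rule mult_right_mono)
      have "card (B - f ` A) \<le> card B" using assms by (intro card_mono) auto
      then show "card (B - f ` A) * ?c \<le> 1" using n by (simp add: field_simps)
    qed simp
    also have "card (f ` A) * ?c ^ card (f ` A) \<le> card A * ?c ^ card (f ` A)"
      using card_image_le[OF insert.hyps(1)] by (intro mult_right_mono) auto
    finally show ?thesis by (simp add: algebra_simps)
  qed
  have "(\<Sum>i\<in>insert x A \<rightarrow>\<^sub>E B. ?c ^ card (i ` insert x A))
      = (\<Sum>f\<in>A \<rightarrow>\<^sub>E B. \<Sum>y\<in>B. ?c ^ card ((f(x := y)) ` insert x A))"
    using insert.hyps by (rule_tac sum_PiE_insert)
  also have "\<dots> \<le> (\<Sum>f\<in>A \<rightarrow>\<^sub>E B. (1 + card A) * ?c ^ card (f ` A))"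
    by (rule sum_mono) (rule step)
  also have "\<dots> = (1 + card A) * (\<Sum>f\<in>A \<rightarrow>\<^sub>E B. ?c ^ card (f ` A))"
    by (simp only: sum_distrib_left)
  also have "\<dots> \<le> (1 + card A) * (fact (card A) :: real)"
    using insert.IH by (rule mult_left_mono) simp
  finally show ?case using insert.hyps by (simp add: algebra_simps)
qed simp

lemma card_le_of_small_subsets:
  assumes "\<A> \<subseteq> Pow {1..d}" "\<And>S. S \<in> \<A> \<Longrightarrow> card S \<le> q" "1 \<le> d"
  shows "card \<A> \<le> (q + 1) * d ^ q"
proof -
  have "card \<A> \<le> card (\<Union>r\<in>{..q}. {S. S \<subseteq> {1..d} \<and> card S = r})"
    using assms by (intro card_mono) (auto intro: finite_subset[of _ "Pow {1..d}"])
  also have "\<dots> \<le> (\<Sum>r\<in>{..q}. card {S. S \<subseteq> {1..d} \<and> card S = r})"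
    by (rule card_UN_le) simp
  also have "\<dots> = (\<Sum>r\<in>{..q}. d choose r)"
    by (intro sum.cong refl) (simp add: n_subsets)
  also have "\<dots> \<le> (\<Sum>r\<in>{..q}. d ^ q)"
  proof (intro sum_mono)
    fix r assume "r \<in> {..q}"
    have "d choose r \<le> d ^ r"
      using binomial_le_pow[of r d] by (cases "r \<le> d") (auto simp: binomial_eq_0)
    also have "\<dots> \<le> d ^ q" using \<open>r \<in> {..q}\<close> assms(3) by (intro power_increasing) auto
    finally show "d choose r \<le> d ^ q" .
  qed
  finally show ?thesis by simp
qed

lemma op_norm_le_of_diagonal:
  fixes A :: "('a, 'a) fmat"
  assumes fin: "finite R" "finite C" and "0 \<le> B"
    and bound: "\<And>r c. r \<in> R \<Longrightarrow> c \<in> C \<Longrightarrow> \<bar>A r c\<bar> \<le> (if r = c then B else 0)"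
  shows "op_norm R C A \<le> B"
  unfolding op_norm_def
proof (rule cSUP_least)
  show "{v. L2_set v C \<le> 1} \<noteq> {}"
    by (auto intro!: exI[of _ "\<lambda>_. 0"] simp: L2_set_def)
next
  fix v :: "'a \<Rightarrow> real"
  assume "v \<in> {v. L2_set v C \<le> 1}"
  then have v: "L2_set v C \<le> 1" by simp
  have row: "\<bar>\<Sum>c\<in>C. A r c * v c\<bar> \<le> (if r \<in> C then B * \<bar>v r\<bar> else 0)" if "r \<in> R" for r
  proof -
    have "\<bar>\<Sum>c\<in>C. A r c * v c\<bar> \<le> (\<Sum>c\<in>C. \<bar>A r c\<bar> * \<bar>v c\<bar>)"
      unfolding abs_mult[symmetric] by (rule sum_abs)
    also have "\<dots> \<le> (\<Sum>c\<in>C. if r = c then B * \<bar>v c\<bar> else 0)"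
    proof (rule sum_mono)
      fix c assume "c \<in> C"
      from mult_right_mono[OF bound[OF that this], of "\<bar>v c\<bar>"]
      show "\<bar>A r c\<bar> * \<bar>v c\<bar> \<le> (if r = c then B * \<bar>v c\<bar> else 0)" by (simp split: if_splits)
    qed
    also have "\<dots> = (if r \<in> C then B * \<bar>v r\<bar> else 0)" using fin by simp
    finally show ?thesis .
  qed
  have "L2_set (\<lambda>r. \<Sum>c\<in>C. A r c * v c) R = L2_set (\<lambda>r. \<bar>\<Sum>c\<in>C. A r c * v c\<bar>) R"
    by (simp add: L2_set_def)
  also have "\<dots> \<le> L2_set (\<lambda>r. if r \<in> C then B * \<bar>v r\<bar> else 0) R"
    by (rule L2_set_mono) (use row in auto)
  also have "\<dots> \<le> L2_set (\<lambda>r. B * v r) C"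
    unfolding L2_set_def
  proof (rule real_sqrt_le_mono)
    have "(\<Sum>r\<in>R. (if r \<in> C then B * \<bar>v r\<bar> else 0)\<^sup>2) = (\<Sum>r\<in>R \<inter> C. (B * v r)\<^sup>2)"
      using fin by (subst sum.inter_restrict) (auto intro!: sum.cong simp: power_mult_distrib)
    also have "\<dots> \<le> (\<Sum>r\<in>C. (B * v r)\<^sup>2)"
      using fin by (intro sum_mono2) auto
    finally show "(\<Sum>r\<in>R. (if r \<in> C then B * \<bar>v r\<bar> else 0)\<^sup>2) \<le> (\<Sum>r\<in>C. (B * v r)\<^sup>2)" .
  qed
  also have "\<dots> = B * L2_set v C" using \<open>0 \<le> B\<close> by (simp add: L2_set_right_distrib)
  also have "\<dots> \<le> B" using v \<open>0 \<le> B\<close> by (simp add: mult_left_le)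
  finally show "L2_set (\<lambda>r. \<Sum>c\<in>C. A r c * v c) R \<le> B" .
qed

lemma le_max_norm:
  assumes "finite I" "k \<in> I"
  shows "w k \<le> max_norm I w"
proof -
  have "\<bar>w k\<bar> \<le> max_norm I w"
    unfolding max_norm_def using assms by (intro Max_ge) auto
  then show ?thesis by simp
qed

lemma max_norm_nonneg: "finite I \<Longrightarrow> 0 \<le> max_norm I w"
  unfolding max_norm_def by (intro Max_ge) auto

definition walk_prod :: "nat \<Rightarrow> (nat \<Rightarrow> nat) \<Rightarrow> (nat \<Rightarrow> nat set) \<Rightarrow> (nat \<Rightarrow> nat \<Rightarrow> real) \<Rightarrow> real" where
  "walk_prod m i \<sigma> x =
     (\<Prod>k\<in>{1..m}. fourier_walsh x (i k) (\<sigma> k) * fourier_walsh x (i k) (\<sigma> (Suc k)))"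

abbreviation cube_samples :: "nat \<Rightarrow> nat \<Rightarrow> (nat \<Rightarrow> nat \<Rightarrow> real) set" where
  "cube_samples n d \<equiv> PiE_dflt {1..n} undefined (\<lambda>_. hypercube d)"

lemma finite_cube_samples: "finite (cube_samples n d)"
  unfolding hypercube_def by (intro finite_PiE_dflt finite_PiE) auto

lemma cube_samples_nonempty: "cube_samples n d \<noteq> {}"
  by (simp add: hypercube_def PiE_eq_empty_iff)

lemma samples_eq: "samples n d = pmf_of_set (cube_samples n d)"
  unfolding samples_def
  by (intro Pi_pmf_of_set) (auto simp: hypercube_def PiE_eq_empty_iff intro: finite_PiE)

lemma set_pmf_samples: "set_pmf (samples n d) = cube_samples n d"
  unfolding samples_eq using cube_samples_nonempty finite_cube_samples by (rule set_pmf_of_set)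

lemma integrable_samples: "integrable (measure_pmf (samples n d)) (f :: _ \<Rightarrow> real)"
  by (rule integrable_measure_pmf_finite) (unfold set_pmf_samples, rule finite_cube_samples)

lemma cube_samples_coord:
  "x \<in> cube_samples n d \<Longrightarrow> r \<in> {1..n} \<Longrightarrow> s \<in> {1..d} \<Longrightarrow> x r s \<in> {-1, 1}"
  by (force simp: PiE_dflt_def hypercube_def)

lemma abs_fourier_walsh:
  assumes "x \<in> cube_samples n d" "r \<in> {1..n}" "S \<subseteq> {1..d}"
  shows "\<bar>fourier_walsh x r S\<bar> = 1"
  unfolding fourier_walsh_def abs_prod
  using cube_samples_coord[OF assms(1,2)] assms(3) by (intro prod.neutral) fastforce

lemma abs_expectation_walk_prod_le:
  assumes "i \<in> {1..m} \<rightarrow> {1..n}" "\<And>k. k \<in> {1..Suc m} \<Longrightarrow> \<sigma> k \<subseteq> {1..d}"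
  shows "\<bar>measure_pmf.expectation (samples n d) (walk_prod m i \<sigma>)\<bar> \<le> 1"
proof -
  have "\<bar>walk_prod m i \<sigma> x\<bar> = 1" if "x \<in> cube_samples n d" for x
    unfolding walk_prod_def abs_prod abs_mult
    using assms by (intro prod.neutral ballI) (auto simp: abs_fourier_walsh[OF that] Pi_iff)
  then have "\<bar>measure_pmf.expectation (samples n d) (walk_prod m i \<sigma>)\<bar>
      \<le> measure_pmf.expectation (samples n d) (\<lambda>_. 1)"
    by (intro order.trans[OF integral_abs_bound] integral_mono_AE integrable_samples)
      (auto simp: AE_measure_pmf_iff set_pmf_samples)
  then show ?thesis by simp
qed

definition flip :: "nat \<Rightarrow> nat \<Rightarrow> (nat \<Rightarrow> nat \<Rightarrow> real) \<Rightarrow> nat \<Rightarrow> nat \<Rightarrow> real" where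
  "flip v s x = x(v := (x v)(s := - x v s))"

lemma flip_flip [simp]: "flip v s (flip v s x) = x"
  by (simp add: flip_def)

lemma flip_cube_samples:
  assumes "x \<in> cube_samples n d" "v \<in> {1..n}" "s \<in> {1..d}"
  shows "flip v s x \<in> cube_samples n d"
proof -
  have "- x v s \<in> {-1, 1}" using cube_samples_coord[OF assms] by auto
  then show ?thesis
    using assms by (auto simp: PiE_dflt_def hypercube_def flip_def PiE_iff extensional_def)
qed

lemma fourier_walsh_flip:
  assumes "finite S"
  shows "fourier_walsh (flip v s x) r S = (-1) ^ of_bool (r = v \<and> s \<in> S) * fourier_walsh x r S"
proof (cases "r = v \<and> s \<in> S")
  case True
  then show ?thesis
    using assms by (auto simp: fourier_walsh_def flip_def prod.remove intro!: prod.cong)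
next
  case False
  then have "fourier_walsh (flip v s x) r S = fourier_walsh x r S"
    unfolding fourier_walsh_def flip_def by (intro prod.cong) auto
  with False show ?thesis by simp
qed

lemma walk_prod_flip:
  assumes "\<And>k. k \<in> {1..Suc m} \<Longrightarrow> finite (\<sigma> k)"
  shows "walk_prod m i \<sigma> (flip v s x) =
    (-1) ^ (\<Sum>k | k \<in> {1..m} \<and> i k = v. of_bool (s \<in> \<sigma> k) + of_bool (s \<in> \<sigma> (Suc k)))
      * walk_prod m i \<sigma> x"
proof -
  have "walk_prod m i \<sigma> (flip v s x) =
    (\<Prod>k\<in>{1..m}. (if i k = v then (-1) ^ (of_bool (s \<in> \<sigma> k) + of_bool (s \<in> \<sigma> (Suc k))) else 1)
      * (fourier_walsh x (i k) (\<sigma> k) * fourier_walsh x (i k) (\<sigma> (Suc k))))"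
    unfolding walk_prod_def
    using assms by (intro prod.cong refl) (simp add: fourier_walsh_flip power_add)
  also have "\<dots> = (\<Prod>k\<in>{1..m}. if i k = v then (-1) ^ (of_bool (s \<in> \<sigma> k) + of_bool (s \<in> \<sigma> (Suc k))) else 1)
      * walk_prod m i \<sigma> x"
    unfolding walk_prod_def by (rule prod.distrib)
  also have "(\<Prod>k\<in>{1..m}. if i k = v then (-1 :: real) ^ (of_bool (s \<in> \<sigma> k) + of_bool (s \<in> \<sigma> (Suc k))) else 1)
      = (\<Prod>k | k \<in> {1..m} \<and> i k = v. (-1) ^ (of_bool (s \<in> \<sigma> k) + of_bool (s \<in> \<sigma> (Suc k))))"
    by (rule prod.inter_filter[symmetric]) simp
  finally show ?thesis by (simp only: power_sum)
qed

lemma expectation_walk_prod_eq_0: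
  assumes nb: "\<not> balanced m i \<sigma>"
    and i: "i \<in> {1..m} \<rightarrow> {1..n}" and \<sigma>: "\<And>k. k \<in> {1..Suc m} \<Longrightarrow> \<sigma> k \<subseteq> {1..d}"
  shows "measure_pmf.expectation (samples n d) (walk_prod m i \<sigma>) = 0"
proof -
  obtain v s where odd:
    "odd (\<Sum>k | k \<in> {1..m} \<and> i k = v. of_bool (s \<in> \<sigma> k) + of_bool (s \<in> \<sigma> (Suc k)) :: nat)"
    using nb unfolding balanced_def by blast
  obtain k where k: "k \<in> {1..m}" "i k = v" "s \<in> \<sigma> k \<or> s \<in> \<sigma> (Suc k)"
  proof (rule ccontr)
    assume "\<not> thesis"
    with that have "(\<Sum>k | k \<in> {1..m} \<and> i k = v. of_bool (s \<in> \<sigma> k) + of_bool (s \<in> \<sigma> (Suc k))) = (0 :: nat)"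
      by (intro sum.neutral) auto
    with odd show False by simp
  qed
  then have v: "v \<in> {1..n}" and s: "s \<in> {1..d}"
    using i \<sigma>[of k] \<sigma>[of "Suc k"] by (auto simp: Pi_iff)
  have fin: "finite (\<sigma> k)" if "k \<in> {1..Suc m}" for k
    using \<sigma>[OF that] finite_subset by blast
  have neg: "walk_prod m i \<sigma> (flip v s x) = - walk_prod m i \<sigma> x" for x
  proof -
    have "walk_prod m i \<sigma> (flip v s x) =
      (-1) ^ (\<Sum>k | k \<in> {1..m} \<and> i k = v. of_bool (s \<in> \<sigma> k) + of_bool (s \<in> \<sigma> (Suc k)))
        * walk_prod m i \<sigma> x"
      by (rule walk_prod_flip) (rule fin)
    also have "\<dots> = - walk_prod m i \<sigma> x"
      unfolding neg_one_odd_power[OF odd] by simp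
    finally show ?thesis .
  qed
  have "(\<Sum>x\<in>cube_samples n d. walk_prod m i \<sigma> x) = (\<Sum>x\<in>cube_samples n d. - walk_prod m i \<sigma> x)"
    by (rule sum.reindex_bij_witness[of _ "flip v s" "flip v s"])
      (simp_all only: flip_cube_samples v s neg flip_flip minus_minus)
  then have "(\<Sum>x\<in>cube_samples n d. walk_prod m i \<sigma> x) = 0" by (simp add: sum_negf)
  then show ?thesis
    unfolding samples_eq using cube_samples_nonempty finite_cube_samples
    by (simp add: integral_pmf_of_set)
qed

lemma weighted_fw_eq:
  assumes "finite \<A>" "S \<in> \<A>"
  shows "weighted_fw \<A> w x r S = w S * fourier_walsh x r S"
  using assms by (simp add: weighted_fw_def fmat_mult_def fmat_diag_def if_distrib sum.delta cong: if_cong)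

lemma gram_factor_eq:
  assumes "finite \<A>"
  shows "fmat_mult \<A> (weighted_fw \<A> w x) (fmat_transpose (weighted_fw \<A> w x)) r r' =
    (\<Sum>U\<in>\<A>. (w U)\<^sup>2 * (fourier_walsh x r U * fourier_walsh x r' U))"
  unfolding fmat_mult_def fmat_transpose_def
  using assms by (intro sum.cong refl) (simp add: weighted_fw_eq power2_eq_square algebra_simps)

lemma gram_prefix_expansion:
  assumes fin: "\<And>k. k \<in> {1..Suc q} \<Longrightarrow> finite (\<S> k)" and S: "S \<in> \<S> 1"
  shows "foldl (fmat_mult {1..n}) (fmat_transpose (weighted_fw (\<S> 1) (w 1) x))
      (map (\<lambda>i. fmat_mult (\<S> i) (weighted_fw (\<S> i) (w i) x)
                  (fmat_transpose (weighted_fw (\<S> i) (w i) x))) [2..<Suc (Suc q)]) S r =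
    (\<Sum>i\<in>{1..q} \<rightarrow>\<^sub>E {1..n}. \<Sum>\<sigma>\<in>Pi\<^sub>E {1..Suc q} (\<S>(1 := {S})).
      w 1 S * (\<Prod>k\<in>{2..Suc q}. (w k (\<sigma> k))\<^sup>2) * walk_prod q i \<sigma> x * fourier_walsh x r (\<sigma> (Suc q)))"
  using fin
proof (induction q arbitrary: r)
  case 0
  have "Pi\<^sub>E {1..Suc 0} (\<S>(1 := {S})) = {\<lambda>k\<in>{1}. S}"
    by (auto simp: PiE_iff extensional_def fun_eq_iff)
  show ?case
    unfolding \<open>Pi\<^sub>E {1..Suc 0} _ = _\<close>
    using 0 S by (simp add: fmat_transpose_def weighted_fw_eq walk_prod_def)
next
  case (Suc q)
  let ?t = "\<lambda>q i \<sigma>. w 1 S * (\<Prod>k\<in>{2..Suc q}. (w k (\<sigma> k))\<^sup>2) * walk_prod q i \<sigma> x"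
  let ?\<chi> = "fourier_walsh x"
  let ?\<S> = "\<S>(1 := {S})"
  have ins: "{1..Suc q} = insert (Suc q) {1..q}" "{1..Suc (Suc q)} = insert (Suc (Suc q)) {1..Suc q}"
    "{2..Suc (Suc q)} = insert (Suc (Suc q)) {2..Suc q}"
    by auto
  have PiE1: "(\<Sum>f\<in>{1..Suc q} \<rightarrow>\<^sub>E {1..n}. g f) = (\<Sum>f\<in>{1..q} \<rightarrow>\<^sub>E {1..n}. \<Sum>y\<in>{1..n}. g (f(Suc q := y)))"
    for g :: "_ \<Rightarrow> real"
    unfolding ins(1) by (rule sum_PiE_insert) simp
  have PiE2: "(\<Sum>f\<in>Pi\<^sub>E {1..Suc (Suc q)} ?\<S>. g f) =
      (\<Sum>f\<in>Pi\<^sub>E {1..Suc q} ?\<S>. \<Sum>U\<in>?\<S> (Suc (Suc q)). g (f(Suc (Suc q) := U)))" for g :: "_ \<Rightarrow> real"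
    unfolding ins(2) by (rule sum_PiE_insert) simp
  have ext: "?t (Suc q) (i(Suc q := r')) (\<sigma>(Suc (Suc q) := U)) * ?\<chi> r U =
      ?t q i \<sigma> * ?\<chi> r' (\<sigma> (Suc q)) * ((w (Suc (Suc q)) U)\<^sup>2 * (?\<chi> r' U * ?\<chi> r U))" for i \<sigma> r' U
  proof -
    have "(\<Prod>k\<in>{2..Suc q}. (w k ((\<sigma>(Suc (Suc q) := U)) k))\<^sup>2) = (\<Prod>k\<in>{2..Suc q}. (w k (\<sigma> k))\<^sup>2)"
      by (intro prod.cong) auto
    moreover have "walk_prod q (i(Suc q := r')) (\<sigma>(Suc (Suc q) := U)) x = walk_prod q i \<sigma> x"
      unfolding walk_prod_def by (intro prod.cong) auto
    moreover have "walk_prod (Suc q) i' \<sigma>' x = walk_prod q i' \<sigma>' x *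
        (?\<chi> (i' (Suc q)) (\<sigma>' (Suc q)) * ?\<chi> (i' (Suc q)) (\<sigma>' (Suc (Suc q))))" for i' \<sigma>'
      by (simp add: walk_prod_def)
    ultimately show ?thesis by (simp add: ins(3))
  qed
  let ?G = "\<lambda>i. fmat_mult (\<S> i) (weighted_fw (\<S> i) (w i) x) (fmat_transpose (weighted_fw (\<S> i) (w i) x))"
  let ?P = "\<lambda>q. foldl (fmat_mult {1..n}) (fmat_transpose (weighted_fw (\<S> 1) (w 1) x)) (map ?G [2..<Suc (Suc q)])"
  have IH: "?P q S r' = (\<Sum>i\<in>{1..q} \<rightarrow>\<^sub>E {1..n}. \<Sum>\<sigma>\<in>Pi\<^sub>E {1..Suc q} ?\<S>. ?t q i \<sigma> * ?\<chi> r' (\<sigma> (Suc q)))" for r'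
    using Suc.prems by (intro Suc.IH) auto
  have G: "?G (Suc (Suc q)) r' r =
      (\<Sum>U\<in>\<S> (Suc (Suc q)). (w (Suc (Suc q)) U)\<^sup>2 * (?\<chi> r' U * ?\<chi> r U))" for r'
    using Suc.prems by (intro gram_factor_eq) auto
  have "?P (Suc q) S r = fmat_mult {1..n} (?P q) (?G (Suc (Suc q))) S r"
    by simp
  also have "\<dots> = (\<Sum>r'\<in>{1..n}. ?P q S r' * ?G (Suc (Suc q)) r' r)"
    by (rule fmat_mult_def[THEN fun_cong, THEN fun_cong])
  also have "\<dots> =
    (\<Sum>r'\<in>{1..n}. (\<Sum>i\<in>{1..q} \<rightarrow>\<^sub>E {1..n}. \<Sum>\<sigma>\<in>Pi\<^sub>E {1..Suc q} ?\<S>. ?t q i \<sigma> * ?\<chi> r' (\<sigma> (Suc q))) *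
      (\<Sum>U\<in>\<S> (Suc (Suc q)). (w (Suc (Suc q)) U)\<^sup>2 * (?\<chi> r' U * ?\<chi> r U)))"
    by (simp only: IH G)
  also have "\<dots> = (\<Sum>r'\<in>{1..n}. \<Sum>i\<in>{1..q} \<rightarrow>\<^sub>E {1..n}. \<Sum>\<sigma>\<in>Pi\<^sub>E {1..Suc q} ?\<S>. \<Sum>U\<in>\<S> (Suc (Suc q)).
      ?t (Suc q) (i(Suc q := r')) (\<sigma>(Suc (Suc q) := U)) * ?\<chi> r U)"
    by (simp only: ext sum_distrib_right) (simp only: sum_distrib_left)
  also have "\<dots> = (\<Sum>i\<in>{1..q} \<rightarrow>\<^sub>E {1..n}. \<Sum>r'\<in>{1..n}. \<Sum>\<sigma>\<in>Pi\<^sub>E {1..Suc q} ?\<S>. \<Sum>U\<in>?\<S> (Suc (Suc q)).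
      ?t (Suc q) (i(Suc q := r')) (\<sigma>(Suc (Suc q) := U)) * ?\<chi> r ((\<sigma>(Suc (Suc q) := U)) (Suc (Suc q))))"
    by (subst sum.swap) simp
  also have "\<dots> = (\<Sum>i\<in>{1..Suc q} \<rightarrow>\<^sub>E {1..n}. \<Sum>\<sigma>\<in>Pi\<^sub>E {1..Suc (Suc q)} ?\<S>.
      ?t (Suc q) i \<sigma> * ?\<chi> r (\<sigma> (Suc (Suc q))))"
    by (simp only: PiE1 PiE2)
  finally show ?case .
qed

lemma gram_product_expansion:
  assumes fin: "\<And>k. k \<in> {1..Suc m} \<Longrightarrow> finite (\<S> k)" and m: "1 \<le> m"
    and S: "S \<in> \<S> 1" and T: "T \<in> \<S> (Suc m)"
  shows "gram_product m n \<S> w x S T = w 1 S * w (Suc m) T *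
    (\<Sum>i\<in>{1..m} \<rightarrow>\<^sub>E {1..n}. \<Sum>\<sigma>\<in>Pi\<^sub>E {1..m} (\<S>(1 := {S})).
      (\<Prod>k\<in>{2..m}. (w k (\<sigma> k))\<^sup>2) * walk_prod m i (\<sigma>(Suc m := T)) x)"
proof -
  obtain q where q: "m = Suc q" using m by (cases m) auto
  let ?\<chi> = "fourier_walsh x"
  let ?t = "\<lambda>i \<sigma>. w 1 S * (\<Prod>k\<in>{2..m}. (w k (\<sigma> k))\<^sup>2) * walk_prod q i \<sigma> x"
  have ins: "{1..m} = insert m {1..q}" using q by auto
  have ext: "?t i \<sigma> * ?\<chi> r (\<sigma> m) * (w (Suc m) T * ?\<chi> r T) =
     w 1 S * w (Suc m) T * ((\<Prod>k\<in>{2..m}. (w k (\<sigma> k))\<^sup>2) * walk_prod m (i(m := r)) (\<sigma>(Suc m := T)) x)"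
    for i \<sigma> r
  proof -
    have "walk_prod q (i(m := r)) (\<sigma>(Suc m := T)) x = walk_prod q i \<sigma> x"
      unfolding walk_prod_def q by (intro prod.cong) auto
    moreover have "walk_prod m i' \<sigma>' x = walk_prod q i' \<sigma>' x *
        (?\<chi> (i' m) (\<sigma>' m) * ?\<chi> (i' m) (\<sigma>' (Suc m)))" for i' \<sigma>'
      by (simp add: walk_prod_def q)
    ultimately show ?thesis by simp
  qed
  have fin': "\<And>k. k \<in> {1..Suc q} \<Longrightarrow> finite (\<S> k)" using fin q by auto
  have "gram_product m n \<S> w x S T = (\<Sum>r\<in>{1..n}. (\<Sum>i\<in>{1..q} \<rightarrow>\<^sub>E {1..n}.
      \<Sum>\<sigma>\<in>Pi\<^sub>E {1..m} (\<S>(1 := {S})). ?t i \<sigma> * ?\<chi> r (\<sigma> m)) * (w (Suc m) T * ?\<chi> r T))"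
    using gram_prefix_expansion[of q \<S> S, OF fin' S] weighted_fw_eq[OF fin T]
    unfolding gram_product_def Let_def fmat_mult_def[of "{1..n}" "foldl _ _ _"] q by simp
  also have "\<dots> = (\<Sum>i\<in>{1..q} \<rightarrow>\<^sub>E {1..n}. \<Sum>r\<in>{1..n}. \<Sum>\<sigma>\<in>Pi\<^sub>E {1..m} (\<S>(1 := {S})).
      w 1 S * w (Suc m) T * ((\<Prod>k\<in>{2..m}. (w k (\<sigma> k))\<^sup>2) * walk_prod m (i(m := r)) (\<sigma>(Suc m := T)) x))"
    by (subst sum.swap) (simp only: ext sum_distrib_right)
  also have "\<dots> = (\<Sum>i\<in>{1..m} \<rightarrow>\<^sub>E {1..n}. \<Sum>\<sigma>\<in>Pi\<^sub>E {1..m} (\<S>(1 := {S})).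
      w 1 S * w (Suc m) T * ((\<Prod>k\<in>{2..m}. (w k (\<sigma> k))\<^sup>2) * walk_prod m i (\<sigma>(Suc m := T)) x))"
    by (subst (3) ins, subst sum_PiE_insert) (auto simp: q)
  finally show ?thesis by (simp only: sum_distrib_left)
qed

lemma walk_weight_bound:
  fixes d n m j :: nat and \<S> :: "nat \<Rightarrow> nat set set" and w :: "nat \<Rightarrow> nat set \<Rightarrow> real" and K :: "nat \<Rightarrow> real"
  assumes d: "1 \<le> d" and n: "1 \<le> n" and j: "j \<in> {2..m}"
    and sub: "\<And>k. k \<in> {1..m} \<Longrightarrow> \<S> k \<subseteq> Pow {1..d}"
    and card: "\<And>k S. k \<in> {1..m} \<Longrightarrow> S \<in> \<S> k \<Longrightarrow> card S \<le> p k"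
    and wn: "\<And>k S. k \<in> {1..m} \<Longrightarrow> S \<in> \<S> k \<Longrightarrow> (w k S)\<^sup>2 \<le> (K k)\<^sup>2 * (1 / n)"
    and wd: "\<And>k S. k \<in> {1..m} \<Longrightarrow> S \<in> \<S> k \<Longrightarrow> (w k S)\<^sup>2 \<le> (K k)\<^sup>2 * (1 / d ^ p k)"
    and S: "S \<in> \<S> 1" "S \<notin> \<S> j"
  shows "(\<Sum>\<sigma> | \<sigma> \<in> Pi\<^sub>E {1..m} (\<S>(1 := {S})) \<and> balanced m i (\<sigma>(Suc m := S)). \<Prod>k\<in>{2..m}. (w k (\<sigma> k))\<^sup>2)
    \<le> (\<Prod>k\<in>{2..m}. (K k)\<^sup>2 * (real (p k) + 1)) * d ^ p j * (1 / n) ^ card (i ` {1..m})"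
    (is "sum ?w ?\<Sigma> \<le> ?c * _ * _")
proof (cases "i ` {1..<j} \<inter> i ` {j..m} = {}")
  case True
  have "\<sigma> \<notin> ?\<Sigma>" for \<sigma>
  proof
    assume \<sigma>: "\<sigma> \<in> ?\<Sigma>"
    then have "balanced m i (\<sigma>(Suc m := S))" by blast
    then have "(\<sigma>(Suc m := S)) 1 = (\<sigma>(Suc m := S)) j"
      by (rule balanced_prefix) (use j True in auto)
    moreover have "\<sigma> k \<in> (\<S>(1 := {S})) k" if "k \<in> {1..m}" for k
      using \<sigma> that by (blast dest: PiE_mem)
    from this[of 1] this[of j] have "\<sigma> 1 = S" "\<sigma> j \<in> \<S> j" using j by auto
    ultimately show False using S(2) j by (simp split: if_splits)
  qed
  then have "sum ?w ?\<Sigma> = 0" by (intro sum.neutral) blast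
  also have "0 \<le> ?c * d ^ p j * (1 / n) ^ card (i ` {1..m})"
    by (intro mult_nonneg_nonneg prod_nonneg) auto
  finally show ?thesis .
next
  case False
  then obtain a where a: "a \<in> {1..<j}" "i a \<in> i ` {j..m}" by blast
  from a(2) obtain b where b: "i a = i b" "b \<in> {j..m}" by (rule imageE)
  from spanning_tree_determines[OF a(1) b(2,1), where 'a = nat]
  obtain T where T: "T \<subseteq> {2..m} - {j}" "Suc (card T) = card (i ` {1..m})"
    and det: "\<And>(\<sigma> :: nat \<Rightarrow> nat set) \<sigma>' k. balanced m i \<sigma> \<Longrightarrow> balanced m i \<sigma>' \<Longrightarrow>
       (\<And>k. k \<in> {1..Suc m} - T \<Longrightarrow> \<sigma> k = \<sigma>' k) \<Longrightarrow> k \<in> T \<Longrightarrow> \<sigma> k = \<sigma>' k"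
    by blast
  let ?\<S> = "\<S>(1 := {S})"
  have fin: "finite (\<S> k)" if "k \<in> {1..m}" for k
    using sub[OF that] finite_subset by blast
  have finS: "finite (?\<S> k)" if "k \<in> {1..m}" for k
    using fin[OF that] by simp
  have card_\<S>: "card (\<S> k) \<le> (p k + 1) * d ^ p k" if "k \<in> {1..m}" for k
    by (rule card_le_of_small_subsets[OF sub[OF that] card[OF that] d])
  have finT: "finite T" using T(1) finite_subset by blast
  have inj: "inj_on (\<lambda>\<sigma>. restrict \<sigma> ({1..m} - T)) ?\<Sigma>"
  proof (rule inj_onI)
    fix \<sigma> \<sigma>' assume \<sigma>: "\<sigma> \<in> ?\<Sigma>" "\<sigma>' \<in> ?\<Sigma>"
      and eq: "restrict \<sigma> ({1..m} - T) = restrict \<sigma>' ({1..m} - T)"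
    have off: "\<sigma> k = \<sigma>' k" if "k \<in> {1..m} - T" for k
      using fun_cong[OF eq, of k] that by simp
    have on: "\<sigma> k = \<sigma>' k" if "k \<in> T" for k
    proof -
      have "balanced m i (\<sigma>(Suc m := S))" "balanced m i (\<sigma>'(Suc m := S))" using \<sigma> by blast+
      then have "(\<sigma>(Suc m := S)) k = (\<sigma>'(Suc m := S)) k"
        by (rule det) (use off that in auto)
      then show ?thesis using that T(1) by (auto split: if_splits)
    qed
    show "\<sigma> = \<sigma>'"
    proof
      fix k
      have "\<sigma> k = undefined" "\<sigma>' k = undefined" if "k \<notin> {1..m}"
        using \<sigma> that by (blast intro: PiE_arb)+
      then show "\<sigma> k = \<sigma>' k" using off[of k] on[of k] by (cases "k \<in> {1..m}") auto
    qed
  qed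
  have "card ?\<Sigma> \<le> card (Pi\<^sub>E ({1..m} - T) ?\<S>)"
    using finS by (intro card_inj_on_le[OF inj] finite_PiE) (auto simp: PiE_iff)
  also have "\<dots> = (\<Prod>k\<in>{1..m} - T. card (?\<S> k))" by (rule card_PiE) simp
  also have "\<dots> = (\<Prod>k\<in>{2..m} - T. card (?\<S> k))"
    using T(1) by (intro prod.mono_neutral_right) auto
  also have "\<dots> = (\<Prod>k\<in>{2..m}. if k \<in> T then 1 else card (?\<S> k))"
    by (rule prod.mono_neutral_cong_left) auto
  also have "\<dots> \<le> (\<Prod>k\<in>{2..m}. if k \<in> T then 1 else (p k + 1) * d ^ p k)"
    using card_\<S> by (intro prod_mono) auto
  finally have count: "real (card ?\<Sigma>) \<le> (\<Prod>k\<in>{2..m}. if k \<in> T then 1 else (p k + 1) * d ^ p k)"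
    by (simp only: of_nat_le_iff flip: of_nat_prod)
  define u where "u k = (K k)\<^sup>2 * (if k \<in> insert j T then 1 / n else 1 / d ^ p k)" for k
  have u0: "0 \<le> u k" for k by (simp add: u_def)
  have "sum ?w ?\<Sigma> \<le> (\<Sum>\<sigma>\<in>?\<Sigma>. \<Prod>k\<in>{2..m}. u k)"
  proof (intro sum_mono prod_mono conjI)
    fix \<sigma> k assume "\<sigma> \<in> ?\<Sigma>" and k: "k \<in> {2..m}"
    then have "\<sigma> k \<in> ?\<S> k" by (intro PiE_mem[of \<sigma> "{1..m}"]) auto
    then have "\<sigma> k \<in> \<S> k" using k by simp
    then show "(w k (\<sigma> k))\<^sup>2 \<le> u k" using wn[of k] wd[of k] k by (auto simp: u_def)
  qed simp
  also have "\<dots> = real (card ?\<Sigma>) * (\<Prod>k\<in>{2..m}. u k)" by simp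
  also have "\<dots> \<le> (\<Prod>k\<in>{2..m}. if k \<in> T then 1 else (p k + 1) * d ^ p k) * (\<Prod>k\<in>{2..m}. u k)"
    using count by (rule mult_right_mono) (intro prod_nonneg u0)
  also have "\<dots> = (\<Prod>k\<in>{2..m}. (if k \<in> T then 1 else (p k + 1) * d ^ p k) * u k)"
    by (simp add: prod.distrib)
  also have "\<dots> \<le> (\<Prod>k\<in>{2..m}. (K k)\<^sup>2 * (real (p k) + 1) * ((if k \<in> insert j T then 1 / n else 1)
      * (if k = j then d ^ p j else 1)))"
  proof (intro prod_mono conjI)
    fix k
    show "0 \<le> real (if k \<in> T then 1 else (p k + 1) * d ^ p k) * u k" using u0 by simp
    have "j \<notin> T" using T(1) by auto
    moreover have "1 * (1 / real n * (K k)\<^sup>2) \<le> (p k + 1) * (1 / real n * (K k)\<^sup>2)"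
      by (rule mult_right_mono) auto
    ultimately show "real (if k \<in> T then 1 else (p k + 1) * d ^ p k) * u k \<le>
        (K k)\<^sup>2 * (real (p k) + 1) * ((if k \<in> insert j T then 1 / n else 1) * (if k = j then d ^ p j else 1))"
      using d by (auto simp: u_def field_simps add_divide_distrib)
  qed
  also have "\<dots> = ?c * ((\<Prod>k\<in>{2..m}. if k \<in> insert j T then 1 / n else 1) *
      (\<Prod>k\<in>{2..m}. real (if k = j then d ^ p j else 1)))"
    by (simp only: prod.distrib)
  also have "(\<Prod>k\<in>{2..m}. real (if k = j then d ^ p j else 1)) = d ^ p j"
    using j by (simp add: if_distrib[of real] cong: if_cong)
  also have "(\<Prod>k\<in>{2..m}. if k \<in> insert j T then 1 / real n else 1) = (\<Prod>k\<in>insert j T. 1 / n)"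
    using T(1) j by (intro prod.mono_neutral_cong_right) auto
  also have "\<dots> = (1 / n) ^ card (i ` {1..m})"
    using T finT by (subst T(2)[symmetric]) (simp add: card_insert_if subset_iff, blast)
  finally show ?thesis by (simp only: mult_ac)
qed

lemma expectation_gram_product:
  assumes fin: "\<And>k. k \<in> {1..Suc m} \<Longrightarrow> finite (\<S> k)" and "1 \<le> m"
    and "S \<in> \<S> 1" "T \<in> \<S> (Suc m)"
  shows "expected_fmat (samples n d) (gram_product m n \<S> w) S T = w 1 S * w (Suc m) T *
    (\<Sum>i\<in>{1..m} \<rightarrow>\<^sub>E {1..n}. \<Sum>\<sigma>\<in>Pi\<^sub>E {1..m} (\<S>(1 := {S})).
      (\<Prod>k\<in>{2..m}. (w k (\<sigma> k))\<^sup>2) *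
        measure_pmf.expectation (samples n d) (walk_prod m i (\<sigma>(Suc m := T))))"
proof -
  have "gram_product m n \<S> w x S T = w 1 S * w (Suc m) T *
    (\<Sum>i\<in>{1..m} \<rightarrow>\<^sub>E {1..n}. \<Sum>\<sigma>\<in>Pi\<^sub>E {1..m} (\<S>(1 := {S})).
      (\<Prod>k\<in>{2..m}. (w k (\<sigma> k))\<^sup>2) * walk_prod m i (\<sigma>(Suc m := T)) x)" for x
    by (rule gram_product_expansion[OF assms])
  then show ?thesis
    by (simp only: expected_fmat_def) (simp add: integrable_samples)
qed

lemma abs_expectation_gram_product_le:
  assumes fin: "\<And>k. k \<in> {1..Suc m} \<Longrightarrow> \<S> k \<subseteq> Pow {1..d}" and m: "1 \<le> m"
    and S: "S \<in> \<S> 1" and T: "T \<in> \<S> (Suc m)"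
  shows "\<bar>expected_fmat (samples n d) (gram_product m n \<S> w) S T\<bar> \<le> \<bar>w 1 S\<bar> * \<bar>w (Suc m) T\<bar> *
    (\<Sum>i\<in>{1..m} \<rightarrow>\<^sub>E {1..n}.
      \<Sum>\<sigma> | \<sigma> \<in> Pi\<^sub>E {1..m} (\<S>(1 := {S})) \<and> balanced m i (\<sigma>(Suc m := T)). \<Prod>k\<in>{2..m}. (w k (\<sigma> k))\<^sup>2)"
proof -
  let ?P = "Pi\<^sub>E {1..m} (\<S>(1 := {S}))"
  let ?E = "\<lambda>i \<sigma>. measure_pmf.expectation (samples n d) (walk_prod m i (\<sigma>(Suc m := T)))"
  let ?w = "\<lambda>\<sigma>. \<Prod>k\<in>{2..m}. (w k (\<sigma> k))\<^sup>2"
  have finite: "finite (\<S> k)" if "k \<in> {1..Suc m}" for k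
    using fin[OF that] finite_subset by blast
  have w0: "0 \<le> ?w \<sigma>" for \<sigma> by (intro prod_nonneg) simp
  have finP: "finite ?P" using finite by (intro finite_PiE) auto
  have summand: "\<bar>?w \<sigma> * ?E i \<sigma>\<bar> \<le> (if balanced m i (\<sigma>(Suc m := T)) then ?w \<sigma> else 0)"
    if i: "i \<in> {1..m} \<rightarrow>\<^sub>E {1..n}" and \<sigma>: "\<sigma> \<in> ?P" for i \<sigma>
  proof -
    have i': "i \<in> {1..m} \<rightarrow> {1..n}" using i by (auto simp: PiE_iff)
    have sub: "(\<sigma>(Suc m := T)) k \<subseteq> {1..d}" if "k \<in> {1..Suc m}" for k
    proof (cases "k = Suc m")
      case True
      then show ?thesis using T fin[OF that] by auto
    next
      case False
      then have "\<sigma> k \<in> (\<S>(1 := {S})) k" using \<sigma> that by (intro PiE_mem[of \<sigma> "{1..m}" "\<S>(1 := {S})"]) auto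
      then have "\<sigma> k \<in> \<S> k" using S by (simp split: if_splits)
      then show ?thesis using False fin[OF that] by auto
    qed
    show ?thesis
    proof (cases "balanced m i (\<sigma>(Suc m := T))")
      case True
      have "\<bar>?E i \<sigma>\<bar> \<le> 1" by (rule abs_expectation_walk_prod_le[OF i' sub])
      then show ?thesis using True w0[of \<sigma>] by (simp add: abs_mult mult_left_le)
    next
      case False
      then have "?E i \<sigma> = 0" by (rule expectation_walk_prod_eq_0[OF _ i' sub])
      then show ?thesis using False by simp
    qed
  qed
  have "\<bar>\<Sum>i\<in>{1..m} \<rightarrow>\<^sub>E {1..n}. \<Sum>\<sigma>\<in>?P. ?w \<sigma> * ?E i \<sigma>\<bar>
      \<le> (\<Sum>i\<in>{1..m} \<rightarrow>\<^sub>E {1..n}. \<Sum>\<sigma>\<in>?P. \<bar>?w \<sigma> * ?E i \<sigma>\<bar>)"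
    by (rule order.trans[OF sum_abs]) (intro sum_mono sum_abs)
  also have "\<dots> \<le> (\<Sum>i\<in>{1..m} \<rightarrow>\<^sub>E {1..n}. \<Sum>\<sigma>\<in>?P. if balanced m i (\<sigma>(Suc m := T)) then ?w \<sigma> else 0)"
    by (intro sum_mono summand)
  also have "\<dots> = (\<Sum>i\<in>{1..m} \<rightarrow>\<^sub>E {1..n}. \<Sum>\<sigma> | \<sigma> \<in> ?P \<and> balanced m i (\<sigma>(Suc m := T)). ?w \<sigma>)"
    by (intro sum.cong refl sum.inter_filter[symmetric] finP)
  finally have bound: "\<bar>\<Sum>i\<in>{1..m} \<rightarrow>\<^sub>E {1..n}. \<Sum>\<sigma>\<in>?P. ?w \<sigma> * ?E i \<sigma>\<bar> \<le> \<dots>" .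
  have "expected_fmat (samples n d) (gram_product m n \<S> w) S T = w 1 S * w (Suc m) T *
      (\<Sum>i\<in>{1..m} \<rightarrow>\<^sub>E {1..n}. \<Sum>\<sigma>\<in>?P. ?w \<sigma> * ?E i \<sigma>)"
    by (rule expectation_gram_product[OF finite m S T])
  then have "\<bar>expected_fmat (samples n d) (gram_product m n \<S> w) S T\<bar> = \<bar>w 1 S\<bar> * \<bar>w (Suc m) T\<bar> *
      \<bar>\<Sum>i\<in>{1..m} \<rightarrow>\<^sub>E {1..n}. \<Sum>\<sigma>\<in>?P. ?w \<sigma> * ?E i \<sigma>\<bar>"
    by (simp only: abs_mult)
  also have "\<dots> \<le> \<bar>w 1 S\<bar> * \<bar>w (Suc m) T\<bar> *
      (\<Sum>i\<in>{1..m} \<rightarrow>\<^sub>E {1..n}. \<Sum>\<sigma> | \<sigma> \<in> ?P \<and> balanced m i (\<sigma>(Suc m := T)). ?w \<sigma>)"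
    by (rule mult_left_mono[OF bound]) simp
  finally show ?thesis .
qed

theorem theorem1:
  fixes m :: nat and p :: "nat \<Rightarrow> nat" and K :: "nat \<Rightarrow> real"
  assumes "1 \<le> m"
  shows "\<exists>C. \<forall>\<^sub>F d in sequentially.
    \<forall>(n :: nat) (\<S> :: nat \<Rightarrow> nat set set) (w :: nat \<Rightarrow> nat set \<Rightarrow> real).
      1 \<le> n \<longrightarrow>
      (\<forall>i\<in>{1..m + 1}. \<S> i \<subseteq> Pow {1..d}) \<longrightarrow>
      (\<forall>i\<in>{1..m + 1}. \<forall>S\<in>\<S> i. 0 \<le> w i S) \<longrightarrow>
      (\<forall>i\<in>{1..m + 1}. \<forall>S\<in>\<S> i. card S \<le> p i) \<longrightarrow>
      (\<forall>i\<in>{1..m + 1}. \<forall>j\<in>{1..m + 1}. \<S> i \<inter> \<S> j \<noteq> {} \<longrightarrow> \<S> i = \<S> j) \<longrightarrow>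
      (\<forall>i\<in>{1..m + 1}. \<forall>S\<in>\<S> i.
         w i S \<le> K i * min (real n powr (- 1 / 2)) (real d powr (- real (p i) / 2))) \<longrightarrow>
      (\<forall>j\<in>{1..m + 1}. \<S> j \<noteq> \<S> 1 \<and> \<S> j \<noteq> \<S> (m + 1) \<longrightarrow>
         op_norm (\<S> 1) (\<S> (m + 1)) (expected_fmat (samples n d) (gram_product m n \<S> w))
           \<le> C * real d ^ p j * max_norm (\<S> 1) (w 1) * max_norm (\<S> (m + 1)) (w (m + 1)))"
proof (intro exI eventually_mono[OF eventually_ge_at_top[of 1]] allI impI ballI)
  let ?c = "\<Prod>k\<in>{2..m}. (K k)\<^sup>2 * (real (p k) + 1)"
  fix d n :: nat and \<S> :: "nat \<Rightarrow> nat set set" and w :: "nat \<Rightarrow> nat set \<Rightarrow> real" and j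
  assume d: "1 \<le> d" and n: "1 \<le> n"
    and sub: "\<forall>i\<in>{1..m + 1}. \<S> i \<subseteq> Pow {1..d}"
    and w0: "\<forall>i\<in>{1..m + 1}. \<forall>S\<in>\<S> i. 0 \<le> w i S"
    and card: "\<forall>i\<in>{1..m + 1}. \<forall>S\<in>\<S> i. card S \<le> p i"
    and disj: "\<forall>i\<in>{1..m + 1}. \<forall>j\<in>{1..m + 1}. \<S> i \<inter> \<S> j \<noteq> {} \<longrightarrow> \<S> i = \<S> j"
    and wle: "\<forall>i\<in>{1..m + 1}. \<forall>S\<in>\<S> i.
         w i S \<le> K i * min (real n powr (- 1 / 2)) (real d powr (- real (p i) / 2))"
    and j: "j \<in> {1..m + 1}" and ne: "\<S> j \<noteq> \<S> 1 \<and> \<S> j \<noteq> \<S> (m + 1)"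
  have j2: "j \<in> {2..m}" using j ne by (cases "j = 1"; cases "j = m + 1") auto
  have fin: "finite (\<S> k)" if "k \<in> {1..m + 1}" for k
    using sub that finite_subset by blast
  have pn: "(real n powr (- 1 / 2))\<^sup>2 = 1 / n"
    using n by (simp add: power2_eq_square powr_minus_divide flip: powr_add)
  have pd: "(real d powr (- real q / 2))\<^sup>2 = 1 / d ^ q" for q
  proof -
    have "(real d powr (- real q / 2))\<^sup>2 = real d powr (- real q)"
      using d by (simp add: power2_eq_square flip: powr_add)
    also have "\<dots> = 1 / d ^ q" using d by (simp add: powr_minus powr_realpow divide_simps)
    finally show ?thesis .
  qed
  have wsq: "(w k S)\<^sup>2 \<le> (K k)\<^sup>2 * (1 / n)" "(w k S)\<^sup>2 \<le> (K k)\<^sup>2 * (1 / d ^ p k)"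
    if k: "k \<in> {1..m}" "S \<in> \<S> k" for k S
  proof -
    let ?x = "min (real n powr (- 1 / 2)) (real d powr (- real (p k) / 2))"
    have wk: "0 \<le> w k S" "w k S \<le> K k * ?x" using w0 wle k by auto
    then have "(w k S)\<^sup>2 \<le> (K k)\<^sup>2 * ?x\<^sup>2"
      using power_mono[OF wk(2,1), of 2] by (simp add: power_mult_distrib)
    moreover have "?x\<^sup>2 \<le> 1 / n" unfolding pn[symmetric] by (intro power_mono) auto
    moreover have "?x\<^sup>2 \<le> 1 / d ^ p k" unfolding pd[symmetric] by (intro power_mono) auto
    ultimately show "(w k S)\<^sup>2 \<le> (K k)\<^sup>2 * (1 / n)" "(w k S)\<^sup>2 \<le> (K k)\<^sup>2 * (1 / d ^ p k)"
      by (meson mult_left_mono order.trans zero_le_power2)+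
  qed
  let ?N1 = "max_norm (\<S> 1) (w 1)" and ?N2 = "max_norm (\<S> (m + 1)) (w (m + 1))"
  let ?D = "fact m * ?c * d ^ p j"
  have c0: "0 \<le> ?c" by (intro prod_nonneg) auto
  have N: "0 \<le> ?N1" "0 \<le> ?N2" using fin by (auto intro!: max_norm_nonneg)
  show "op_norm (\<S> 1) (\<S> (m + 1)) (expected_fmat (samples n d) (gram_product m n \<S> w))
           \<le> (fact m * ?c) * real d ^ p j * ?N1 * ?N2"
  proof (rule op_norm_le_of_diagonal)
    show "0 \<le> (fact m * ?c) * real d ^ p j * ?N1 * ?N2"
      using c0 N by (intro mult_nonneg_nonneg) auto
    fix S T assume S: "S \<in> \<S> 1" and T: "T \<in> \<S> (m + 1)"
    let ?B = "\<lambda>i. {\<sigma>. \<sigma> \<in> Pi\<^sub>E {1..m} (\<S>(1 := {S})) \<and> balanced m i (\<sigma>(Suc m := T))}"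
    let ?W = "\<Sum>i\<in>{1..m} \<rightarrow>\<^sub>E {1..n}. \<Sum>\<sigma>\<in>?B i. \<Prod>k\<in>{2..m}. (w k (\<sigma> k))\<^sup>2"
    have entry: "\<bar>expected_fmat (samples n d) (gram_product m n \<S> w) S T\<bar> \<le> \<bar>w 1 S\<bar> * \<bar>w (Suc m) T\<bar> * ?W"
      using sub S T assms by (intro abs_expectation_gram_product_le) auto
    show "\<bar>expected_fmat (samples n d) (gram_product m n \<S> w) S T\<bar>
        \<le> (if S = T then (fact m * ?c) * real d ^ p j * ?N1 * ?N2 else 0)"
    proof (cases "S = T")
      case False
      have "\<sigma> \<notin> ?B i" for i \<sigma>
      proof
        assume \<sigma>: "\<sigma> \<in> ?B i"
        then have "balanced m i (\<sigma>(Suc m := T))" by blast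
        then have "(\<sigma>(Suc m := T)) 1 = (\<sigma>(Suc m := T)) (Suc m)"
          by (rule balanced_prefix) auto
        moreover have "\<sigma> 1 \<in> (\<S>(1 := {S})) 1"
          using \<sigma> assms by (intro PiE_mem[of \<sigma> "{1..m}" "\<S>(1 := {S})"]) auto
        ultimately show False using False assms by simp
      qed
      then have "?W = 0" by (intro sum.neutral ballI) blast
      then show ?thesis using entry False by simp
    next
      case True
      have "\<S> j \<inter> \<S> 1 \<noteq> {} \<longrightarrow> \<S> j = \<S> 1" using disj j by auto
      then have Sj: "S \<notin> \<S> j" using S ne by blast
      have "?W \<le> (\<Sum>i\<in>{1..m} \<rightarrow>\<^sub>E {1..n}. ?c * d ^ p j * (1 / n) ^ card (i ` {1..m}))"
        unfolding True[symmetric]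
        using sub card wsq S Sj by (intro sum_mono walk_weight_bound[OF d n j2]) auto
      also have "\<dots> = ?c * d ^ p j * (\<Sum>i\<in>{1..m} \<rightarrow>\<^sub>E {1..n}. (1 / n) ^ card (i ` {1..m}))"
        by (simp only: sum_distrib_left)
      also have "\<dots> \<le> ?c * d ^ p j * fact m"
        using sum_power_card_image_le[of "{1..m}" "{1..n}"] n c0 by (intro mult_left_mono) auto
      finally have W: "?W \<le> ?D" by (simp add: mult_ac)
      have "\<bar>w 1 S\<bar> = w 1 S" "\<bar>w (Suc m) T\<bar> = w (m + 1) T" using w0 S T by auto
      then have w: "\<bar>w 1 S\<bar> * \<bar>w (Suc m) T\<bar> \<le> ?N1 * ?N2"
        using le_max_norm[of "\<S> 1" S "w 1"] le_max_norm[of "\<S> (m + 1)" T "w (m + 1)"] fin S T N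
        by (simp add: mult_mono)
      have "\<bar>w 1 S\<bar> * \<bar>w (Suc m) T\<bar> * ?W \<le> ?N1 * ?N2 * ?D"
        by (rule mult_mono[OF w W]) (use N in \<open>auto intro!: sum_nonneg prod_nonneg\<close>)
      then show ?thesis using entry True by (simp add: mult_ac)
    qed
  qed (use fin in auto)
qed

end
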